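(* Assume that $V_t$ and $V_x$ are finite-dimensional and that assumptions $(A1)$, $(A2)$, $(A3)$ and $(A4)$ (stated in the context) hold. Let $(u_n)_{n\in\mathbb{N}^*}$ be a sequence generated by the greedy algorithm (described in the context). Then there exist two constants $\tau>0$ and $\sigma\in(0,1)$ such that for all $n\in\mathbb{N}^*$, $$0\le \mathcal{E}(u_n)-\mathcal{E}(u)\le \tau\sigma^n$$ and $$\|u-u_n\|_V\le\sqrt{\frac{2\tau}{\alpha}}\,\sigma^{n/2}.$$
   Context: Let $p,d$ be positive integers and $\mathcal{T}\subset\mathbb{R}^p$, $\mathcal{X}\subset\mathbb{R}^d$ open sets. $V_t$ and $V_x$ are Hilbert spaces of real-valued functions on $\mathcal{T}$ and $\mathcal{X}$ respectively. For $(r,s)\in V_t\times V_x$, $r\otimes s$ is the function $(t,x)\mapsto r(t)s(x)$ on $\mathcal{T}\times\mathcal{X}$, and $\Sigma=\{r\otimes s \mid (r,s)\in V_t\times V_x\}$. $V$ is a Hilbert space of real-valued functions on $\mathcal{T}\times\mathcal{X}$ with scalar product $\langle\cdot,\cdot\rangle$ and norm $\|\cdot\|_V$. $\mathcal{E}:V\to\mathbb{R}$ is differentiable, and $\mathcal{E}'(v)\in V$ denotes its gradient at $v$. $\mathbb{N}^*=\{1,2,\dots\}$. Assumptions: - $(A1)$ $\mathrm{Span}(\Sigma)$ is a dense subset of $V$ for $\|\cdot\|_V$ (in particular $\Sigma\subset V$). - $(A2)$ For every sequence of elements of $\Sigma$ bounded in $V$, there is a subsequence converging weakly in $V$ to an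 element of $\Sigma$. - $(A3)$ $\mathcal{E}$ is strongly convex: there is $\alpha>0$ such that for all $v,w\in V$, $\mathcal{E}(v)\ge \mathcal{E}(w)+\langle \mathcal{E}'(w),v-w\rangle+\frac{\alpha}{2}\|v-w\|_V^2$. The constant $\alpha$ in the claim is this one. - $(A4)$ The gradient of $\mathcal{E}$ is Lipschitz on bounded sets: for each bounded $K\subset V$ there is $L_K\ge 0$ such that $\|\mathcal{E}'(v)-\mathcal{E}'(w)\|_V\le L_K\|v-w\|_V$ for all $v,w\in K$. $u$ denotes the unique global minimizer of $\mathcal{E}$ on $V$. Greedy algorithm: recursively for $n\in\mathbb{N}^*$, choose $(r_n,s_n)\in\mathrm{argmin}_{(r,s)\in V_t\times V_x}\mathcal{E}\left(\sum_{k=1}^{n-1} r_k\otimes s_k+r\otimes s\right)$ (under the assumptions a minimizer exists, not necessarily unique), and set $u_n=\sum_{k=1}^n r_k\otimes s_k$. *)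

theory Defs
  imports "HOL-Analysis.Analysis"
begin

text \<open>
  A Hilbert space of real-valued functions on a set \<open>S\<close> is a type of class
  \<open>{real_inner, complete_space}\<close> together with an evaluation map \<open>ev\<close>:
  \<open>ev v x\<close> is the value at \<open>x\<close> of the function \<open>v\<close>. Vector space operations are the pointwise
  ones, and elements agreeing as functions on \<open>S\<close> are equal. The values of
  \<open>ev v\<close> outside \<open>S\<close> carry no information.
\<close>

definition function_space_on ::
  "'a set \<Rightarrow> ('v::{real_inner, complete_space} \<Rightarrow> 'a \<Rightarrow> real) \<Rightarrow> bool" where
  "function_space_on S ev \<longleftrightarrow>
     (\<forall>x\<in>S. linear (\<lambda>v. ev v x)) \<and>
     (\<forall>v w. (\<forall>x\<in>S. ev v x = ev w x) \<longrightarrow> v = w)"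

text \<open>
  \<open>tens r s\<close> is the element of \<open>V\<close> whose underlying function on \<open>T \<times> X\<close> is
  \<open>(t, x) \<mapsto> r(t) s(x)\<close>. It is unique by injectivity of \<open>ev\<close>; its existence for
  all \<open>r\<close>, \<open>s\<close> says that the rank-one functions belong to \<open>V\<close>.
\<close>

definition is_tensor_product ::
  "'a set \<Rightarrow> 'b set \<Rightarrow> ('r \<Rightarrow> 'a \<Rightarrow> real) \<Rightarrow> ('s \<Rightarrow> 'b \<Rightarrow> real) \<Rightarrow>
   ('v \<Rightarrow> 'a \<times> 'b \<Rightarrow> real) \<Rightarrow> ('r \<Rightarrow> 's \<Rightarrow> 'v) \<Rightarrow> bool" where
  "is_tensor_product T X evt evx ev tens \<longleftrightarrow>
     (\<forall>r s. \<forall>t\<in>T. \<forall>x\<in>X. ev (tens r s) (t, x) = evt r t * evx s x)"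

definition rank_one :: "('r \<Rightarrow> 's \<Rightarrow> 'v) \<Rightarrow> 'v set" where
  "rank_one tens = {tens r s | r s. True}"

definition weakly_converges_to :: "(nat \<Rightarrow> 'v::real_normed_vector) \<Rightarrow> 'v \<Rightarrow> bool" where
  "weakly_converges_to z w \<longleftrightarrow>
     (\<forall>f :: 'v \<Rightarrow> real. bounded_linear f \<longrightarrow> (\<lambda>n. f (z n)) \<longlonglongrightarrow> f w)"

definition weakly_seq_compact_on_bounded :: "'v::real_normed_vector set \<Rightarrow> bool" where
  "weakly_seq_compact_on_bounded A \<longleftrightarrow>
     (\<forall>z :: nat \<Rightarrow> 'v. range z \<subseteq> A \<and> bounded (range z) \<longrightarrow>
        (\<exists>\<phi> w. strict_mono \<phi> \<and> w \<in> A \<and> weakly_converges_to (z \<circ> \<phi>) w))"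

definition greedy_iterate :: "('r \<Rightarrow> 's \<Rightarrow> 'v::comm_monoid_add) \<Rightarrow> (nat \<Rightarrow> 'r) \<Rightarrow> (nat \<Rightarrow> 's) \<Rightarrow> nat \<Rightarrow> 'v" where
  "greedy_iterate tens r s n = (\<Sum>k=1..n. tens (r k) (s k))"

text \<open>Only the indices \<open>n \<ge> 1\<close> matter; \<open>r 0\<close> and \<open>s 0\<close> are never used.\<close>

definition greedy_choice ::
  "('v::comm_monoid_add \<Rightarrow> real) \<Rightarrow> ('r \<Rightarrow> 's \<Rightarrow> 'v) \<Rightarrow> (nat \<Rightarrow> 'r) \<Rightarrow> (nat \<Rightarrow> 's) \<Rightarrow> bool" where
  "greedy_choice E tens r s \<longleftrightarrow>
     (\<forall>n\<ge>1. is_arg_min (\<lambda>(a, b). E ((\<Sum>k=1..<n. tens (r k) (s k)) + tens a b))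
        (\<lambda>_. True) (r n, s n))"

end

theory Submission
  imports Defs
begin

text \<open>
  The greedy step at \<open>v\<close> with gradient \<open>g\<close> minimises the energy over \<open>v + \<Sigma>\<close>, and \<open>\<Sigma>\<close> is a cone,
  so it does at least as well as a gradient step \<open>v - t (g \<bullet> b) b\<close> along any fixed
  \<open>b \<in> \<Sigma>\<close>. Such a step gains at least a multiple of \<open>(g \<bullet> b)\<^sup>2\<close>, because the gradient is Lipschitz on
  a bounded set containing everything that occurs; all iterates stay in the sublevel
  set of \<open>0\<close>, which strong convexity makes bounded.

  Finite dimension enters once: finitely many \<open>b \<in> \<Sigma>\<close> already span \<open>V\<close>, so \<open>g\<close> cannot be nearly
  orthogonal to all of them, and \<open>\<parallel>g\<parallel>\<^sup>2\<close> is bounded by a multiple of \<open>\<Sum>b. (g \<bullet> b)\<^sup>2\<close>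
  (\<open>norm_sq_le_sum_inner_sq\<close>). Hence every step gains a multiple of \<open>\<parallel>g\<parallel>\<^sup>2\<close>. Strong
  convexity bounds the energy excess \<open>E v - E u\<close> by a multiple of \<open>\<parallel>g\<parallel>\<^sup>2\<close>, so each step removes
  at least a fixed fraction of the excess (\<open>line_search_contraction\<close>): the excess decays
  geometrically. The error in norm follows since the excess dominates
  \<open>\<alpha>/2 \<parallel>v - u\<parallel>\<^sup>2\<close>.
\<close>

section \<open>Testing a vector against a finite spanning set\<close>

lemma span_inner_sq_le:
  fixes B :: "'v::real_inner set"
  assumes "finite B" "c \<in> span B"
  shows "\<exists>K\<ge>0. \<forall>g. (g \<bullet> c)\<^sup>2 \<le> K * (\<Sum>b\<in>B. (g \<bullet> b)\<^sup>2)"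
  using assms(2)
proof (induction rule: span_induct_alt)
  case base
  then show ?case by (intro exI[of _ 0]) auto
next
  case (step k x y)
  then obtain K where K: "K \<ge> 0" "\<And>g. (g \<bullet> y)\<^sup>2 \<le> K * (\<Sum>b\<in>B. (g \<bullet> b)\<^sup>2)"
    by blast
  show ?case
  proof (intro exI[of _ "2 * k\<^sup>2 + 2 * K"] conjI allI)
    show "0 \<le> 2 * k\<^sup>2 + 2 * K" using K(1) by simp
    fix g
    have x: "(g \<bullet> x)\<^sup>2 \<le> (\<Sum>b\<in>B. (g \<bullet> b)\<^sup>2)"
      using assms(1) \<open>x \<in> B\<close> by (intro member_le_sum) auto
    have "(g \<bullet> (k *\<^sub>R x + y))\<^sup>2 \<le> 2 * (k * (g \<bullet> x))\<^sup>2 + 2 * (g \<bullet> y)\<^sup>2"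
      using sum_squares_bound[of "k * (g \<bullet> x)" "g \<bullet> y"]
      by (simp add: inner_add_right power2_sum)
    also have "\<dots> \<le> 2 * (k\<^sup>2 * (\<Sum>b\<in>B. (g \<bullet> b)\<^sup>2)) + 2 * (K * (\<Sum>b\<in>B. (g \<bullet> b)\<^sup>2))"
      using mult_left_mono[OF x, of "k\<^sup>2"] K(2)[of g] by (simp add: power_mult_distrib)
    finally show "(g \<bullet> (k *\<^sub>R x + y))\<^sup>2 \<le> (2 * k\<^sup>2 + 2 * K) * (\<Sum>b\<in>B. (g \<bullet> b)\<^sup>2)"
      by (simp add: algebra_simps)
  qed
qed

text \<open>
  This replaces norm equivalence in finite dimension. An orthogonal basis \<open>C\<close> of \<open>span B\<close> gives
  \<open>\<parallel>g\<parallel>\<^sup>2\<close> exactly as a weighted sum of the \<open>(g \<bullet> c)\<^sup>2\<close>: the difference between \<open>g\<close> and its projection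
  on \<open>span B\<close> is orthogonal to a dense set. Every \<open>c \<in> C\<close> is a combination of
  elements of \<open>B\<close>.
\<close>

lemma norm_sq_le_sum_inner_sq:
  fixes B :: "'v::real_inner set"
  assumes "finite B" and dense: "closure (span B) = UNIV"
  shows "\<exists>K>0. \<forall>g. (norm g)\<^sup>2 \<le> K * (\<Sum>b\<in>B. (g \<bullet> b)\<^sup>2)"
proof -
  obtain C where C: "finite C" "span C = span B" "pairwise orthogonal C"
    using basis_orthogonal[OF assms(1)] by blast
  have expand: "(norm g)\<^sup>2 = (\<Sum>c\<in>C. (g \<bullet> c)\<^sup>2 / (c \<bullet> c))" for g
  proof -
    define p where "p = (\<Sum>c\<in>C. (c \<bullet> g / (c \<bullet> c)) *\<^sub>R c)"
    let ?H = "{x. (g - p) \<bullet> x = 0}"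
    have "(g - p) \<bullet> c = 0" if "c \<in> C" for c
    proof -
      have "p \<bullet> c = (\<Sum>d\<in>C. d \<bullet> g / (d \<bullet> d) * (d \<bullet> c))"
        by (simp add: p_def inner_sum_left)
      also have "\<dots> = (\<Sum>d\<in>C. if d = c then d \<bullet> g else 0)"
      proof (intro sum.cong refl)
        fix d assume "d \<in> C"
        then have "d \<noteq> c \<Longrightarrow> d \<bullet> c = 0"
          using pairwiseD[OF C(3)] that by (auto simp: orthogonal_def)
        then show "d \<bullet> g / (d \<bullet> d) * (d \<bullet> c) = (if d = c then d \<bullet> g else 0)"
          by simp
      qed
      also have "\<dots> = g \<bullet> c"
        using C(1) that by (simp add: inner_commute)
      finally show ?thesis
        by (simp add: inner_diff_left)
    qed
    then have "span C \<subseteq> ?H"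
      by (intro span_minimal subspace_hyperplane) auto
    moreover have "closed ?H" by (rule closed_hyperplane)
    ultimately have "closure (span B) \<subseteq> ?H"
      using C(2) by (simp add: closure_minimal)
    then have "g - p \<in> ?H"
      unfolding dense by (rule subsetD) (rule UNIV_I)
    then have "g = p" by simp
    then have "g \<bullet> g = g \<bullet> p" by simp
    also have "\<dots> = (\<Sum>c\<in>C. (g \<bullet> c)\<^sup>2 / (c \<bullet> c))"
      unfolding p_def by (simp add: inner_sum_right power2_eq_square inner_commute)
    finally show ?thesis by (simp add: power2_norm_eq_inner)
  qed
  have "\<forall>c\<in>C. \<exists>K\<ge>0. \<forall>g. (g \<bullet> c)\<^sup>2 \<le> K * (\<Sum>b\<in>B. (g \<bullet> b)\<^sup>2)"
    using span_inner_sq_le[OF assms(1)] C(2) span_base by blast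
  then obtain k where k: "\<And>c. c \<in> C \<Longrightarrow> k c \<ge> (0::real)"
      "\<And>c g. c \<in> C \<Longrightarrow> (g \<bullet> c)\<^sup>2 \<le> k c * (\<Sum>b\<in>B. (g \<bullet> b)\<^sup>2)"
    by metis
  define K where "K = (\<Sum>c\<in>C. k c / (c \<bullet> c))"
  have "(norm g)\<^sup>2 \<le> (K + 1) * (\<Sum>b\<in>B. (g \<bullet> b)\<^sup>2)" for g
  proof -
    have "(norm g)\<^sup>2 \<le> (\<Sum>c\<in>C. (k c * (\<Sum>b\<in>B. (g \<bullet> b)\<^sup>2)) / (c \<bullet> c))"
      unfolding expand using k(2) by (intro sum_mono divide_right_mono) auto
    also have "\<dots> = K * (\<Sum>b\<in>B. (g \<bullet> b)\<^sup>2)"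
      unfolding K_def sum_distrib_right by simp
    also have "\<dots> \<le> (K + 1) * (\<Sum>b\<in>B. (g \<bullet> b)\<^sup>2)"
      by (intro mult_right_mono sum_nonneg) auto
    finally show ?thesis .
  qed
  moreover have "K \<ge> 0"
    unfolding K_def using k(1) by (intro sum_nonneg divide_nonneg_nonneg) auto
  ultimately show ?thesis
    by (intro exI[of _ "K + 1"]) auto
qed

section \<open>Strongly convex energies\<close>

lemma gradient_zero_at_minimizer:
  fixes E :: "'v::real_inner \<Rightarrow> real"
  assumes "GDERIV E u :> g" and "\<And>v. E u \<le> E v"
  shows "g = 0"
proof -
  have "(\<lambda>h. g \<bullet> h) = (\<lambda>h. 0)"
    using assms
    by (intro has_derivative_local_min[of E _ u])
      (auto simp: gderiv_def inner_commute)
  then have "g \<bullet> g = 0" by metis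
  then show ?thesis by simp
qed

text \<open>
  The Polyak-Lojasiewicz inequality: minimising the quadratic lower bound at \<open>v\<close> over all
  of \<open>V\<close> gives \<open>E v - \<parallel>E' v\<parallel>\<^sup>2/(2\<alpha>)\<close>.
\<close>

lemma energy_excess_le_gradient_sq:
  fixes E :: "'v::real_inner \<Rightarrow> real"
  assumes "\<alpha> > 0"
    and convex: "\<And>v w. E v \<ge> E w + E' w \<bullet> (v - w) + \<alpha> / 2 * (norm (v - w))\<^sup>2"
  shows "2 * \<alpha> * (E v - E u) \<le> (norm (E' v))\<^sup>2"
proof -
  have "0 \<le> (norm (E' v + \<alpha> *\<^sub>R (u - v)))\<^sup>2" by simp
  also have "\<dots> = (norm (E' v))\<^sup>2 + 2 * \<alpha> * (E' v \<bullet> (u - v) + \<alpha> / 2 * (norm (u - v))\<^sup>2)"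
    unfolding power2_norm_eq_inner
    by (simp add: inner_add_left inner_add_right inner_commute algebra_simps power2_eq_square)
  also have "\<dots> \<le> (norm (E' v))\<^sup>2 + 2 * \<alpha> * (E u - E v)"
    using convex[of v u] assms(1) by (intro add_left_mono mult_left_mono) auto
  finally show ?thesis by (simp add: algebra_simps)
qed

text \<open>
  A descent estimate without integration along the segment: convexity at the endpoint \<open>v + h\<close>
  bounds the increment by \<open>E' (v + h) \<bullet> h\<close>, and the Lipschitz bound moves the gradient back
  to \<open>v\<close>. The price is the factor \<open>L\<close> instead of \<open>L/2\<close>.
\<close>

lemma convex_descent:
  fixes E :: "'v::real_inner \<Rightarrow> real"
  assumes convex: "\<And>v w. E v \<ge> E w + E' w \<bullet> (v - w)"
    and lip: "L-lipschitz_on S E'" and "v \<in> S" "v + h \<in> S"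
  shows "E (v + h) \<le> E v + E' v \<bullet> h + L * (norm h)\<^sup>2"
proof -
  have "E (v + h) \<le> E v + E' (v + h) \<bullet> h"
    using convex[of "v + h" v] by simp
  also have "\<dots> = E v + E' v \<bullet> h + (E' (v + h) - E' v) \<bullet> h"
    by (simp add: inner_diff_left)
  also have "(E' (v + h) - E' v) \<bullet> h \<le> norm (E' (v + h) - E' v) * norm h"
    by (rule norm_cauchy_schwarz)
  also have "\<dots> \<le> (L * norm h) * norm h"
    using lipschitz_onD[OF lip assms(4,3)] by (intro mult_right_mono) (auto simp: dist_norm)
  finally show ?thesis by (simp add: power2_eq_square)
qed

text \<open>
  Among the steps along the directions \<open>b \<in> B\<close>, one must gain a multiple of \<open>\<parallel>E' v\<parallel>\<^sup>2\<close>, hence of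
  the energy excess. The factor \<open>\<sigma>\<close> is uniform over the sublevel set \<open>{v. E v \<le> M}\<close>, which is
  what lets the estimate be iterated. The point \<open>w\<close> is only compared in energy with all these
  steps and need not be reached by one of them, since the greedy algorithm may move in
  a direction outside \<open>B\<close>.
\<close>

lemma line_search_contraction:
  fixes E :: "'v::real_inner \<Rightarrow> real" and B :: "'v set"
  assumes "\<alpha> > 0"
    and convex: "\<And>v w. E v \<ge> E w + E' w \<bullet> (v - w) + \<alpha> / 2 * (norm (v - w))\<^sup>2"
    and lip: "\<And>K. bounded K \<Longrightarrow> \<exists>L. L-lipschitz_on K E'"
    and crit: "E' u = 0"
    and "finite B" and dense: "closure (span B) = UNIV"
  shows "\<exists>\<sigma>::real. 0 < \<sigma> \<and> \<sigma> < 1 \<and>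
    (\<forall>v w. E v \<le> M \<longrightarrow> E w \<le> E v \<longrightarrow> (\<forall>b\<in>B. \<forall>c. E w \<le> E (v + c *\<^sub>R b)) \<longrightarrow>
       E w - E u \<le> \<sigma> * (E v - E u))"
proof -
  have growth: "\<alpha> / 2 * (norm (v - u))\<^sup>2 \<le> E v - E u" for v
    using convex[of u v] crit by simp
  have convex': "E v \<ge> E w + E' w \<bullet> (v - w)" for v w
    using convex[of w v] assms(1) by (smt (verit) zero_le_power2 mult_nonneg_nonneg divide_nonneg_nonneg)
  obtain K where K: "K > 0" "\<And>g. (norm g)\<^sup>2 \<le> K * (\<Sum>b\<in>B. (g \<bullet> b)\<^sup>2)"
    using norm_sq_le_sum_inner_sq[OF assms(5) dense] by blast

  \<comment> \<open>\<open>\<rho>\<close> bounds the distance to \<open>u\<close> and \<open>G\<close> the gradient on the sublevel set, and \<open>R\<close> bounds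
    \<open>\<parallel>b\<parallel>\<^sup>2\<close>. A step \<open>t (g \<bullet> b) b\<close> with \<open>t \<le> 1\<close> has norm at most \<open>G R\<close>, so it stays in the ball of
    radius \<open>\<rho> + G R\<close>.\<close>
  define \<rho> where "\<rho> = sqrt (2 / \<alpha> * \<bar>M - E u\<bar>)"
  define R where "R = (\<Sum>b\<in>B. (norm b)\<^sup>2)"
  have R: "(norm b)\<^sup>2 \<le> R" if "b \<in> B" for b
    unfolding R_def using assms(5) that by (intro member_le_sum) auto
  have R0: "R \<ge> 0" unfolding R_def by (intro sum_nonneg) auto
  have \<rho>0: "\<rho> \<ge> 0" using assms(1) by (simp add: \<rho>_def)
  have dist_le: "norm (v - u) \<le> \<rho>" if "E v \<le> M" for v
  proof -
    have "\<alpha> / 2 * (norm (v - u))\<^sup>2 \<le> \<bar>M - E u\<bar>"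
      using growth[of v] that by linarith
    then have "(norm (v - u))\<^sup>2 \<le> 2 / \<alpha> * \<bar>M - E u\<bar>"
      using assms(1) by (simp add: field_simps)
    then show ?thesis unfolding \<rho>_def by (rule real_le_rsqrt)
  qed
  obtain L0 where L0: "L0-lipschitz_on (cball u \<rho>) E'"
    using lip bounded_cball by blast
  define G where "G = L0 * \<rho>"
  have G0: "G \<ge> 0" using lipschitz_on_nonneg[OF L0] \<rho>0 by (simp add: G_def)
  have grad_le: "norm (E' v) \<le> G" if "E v \<le> M" for v
  proof -
    have "norm (E' v) \<le> L0 * norm (v - u)"
      using lipschitz_onD[OF L0, of v u] dist_le[OF that] \<rho>0 crit
      by (simp add: dist_norm norm_minus_commute)
    also have "\<dots> \<le> G"
      unfolding G_def using dist_le[OF that] lipschitz_on_nonneg[OF L0] by (rule mult_left_mono)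
    finally show ?thesis .
  qed
  obtain L where L: "L-lipschitz_on (cball u (\<rho> + G * R)) E'"
    using lip bounded_cball by blast
  have LR: "L * R \<ge> 0" using lipschitz_on_nonneg[OF L] R0 by simp

  \<comment> \<open>With this step length the quadratic error eats at most half of the first-order gain.\<close>
  define t where "t = 1 / (2 * (1 + L * R))"
  have t: "0 < t" "t \<le> 1" "L * R * t \<le> 1 / 2"
    using LR by (auto simp: t_def field_simps)
  have gain: "t / 2 * (E' v \<bullet> b)\<^sup>2 \<le> E v - E w"
    if "E v \<le> M" "b \<in> B" "\<And>c. E w \<le> E (v + c *\<^sub>R b)" for v w b
  proof -
    define a where "a = E' v \<bullet> b"
    define h where "h = (- t * a) *\<^sub>R b"
    have "norm h \<le> 1 * \<bar>a\<bar> * norm b"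
      unfolding h_def using t by (simp add: abs_mult mult_right_mono mult_left_le_one_le)
    also have "\<dots> \<le> (norm (E' v) * norm b) * norm b"
      unfolding a_def using Cauchy_Schwarz_ineq2[of "E' v" b] by (simp add: mult_right_mono)
    also have "\<dots> \<le> G * R"
      using mult_mono[OF grad_le[OF that(1)] R[OF that(2)] G0] by (simp add: power2_eq_square mult.assoc)
    finally have h_le: "norm h \<le> G * R" .
    have "E (v + h) \<le> E v + E' v \<bullet> h + L * (norm h)\<^sup>2"
    proof (rule convex_descent[OF convex' L])
      show "v \<in> cball u (\<rho> + G * R)"
        using dist_le[OF that(1)] G0 R0 by (simp add: dist_norm norm_minus_commute add_increasing2)
      show "v + h \<in> cball u (\<rho> + G * R)"
        using dist_le[OF that(1)] h_le norm_triangle_ineq[of "v - u" h]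
        by (simp add: dist_norm norm_minus_commute algebra_simps)
    qed
    also have "E' v \<bullet> h = - t * a\<^sup>2"
      by (simp add: h_def a_def power2_eq_square)
    also have "L * (norm h)\<^sup>2 = (t * a\<^sup>2) * (t * (L * (norm b)\<^sup>2))"
      by (simp add: h_def power_mult_distrib power2_eq_square)
    also have "\<dots> \<le> (t * a\<^sup>2) * (1 / 2)"
    proof (rule mult_left_mono)
      have "t * (L * (norm b)\<^sup>2) \<le> t * (L * R)"
        using R[OF that(2)] lipschitz_on_nonneg[OF L] t(1) by (intro mult_left_mono) auto
      then show "t * (L * (norm b)\<^sup>2) \<le> 1 / 2"
        using t(3) by (simp add: algebra_simps)
    qed (use t in auto)
    finally have "E (v + h) \<le> E v - t / 2 * a\<^sup>2" by simp
    moreover have "E w \<le> E (v + h)"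
      unfolding h_def by (rule that(3))
    ultimately show ?thesis by (simp add: a_def)
  qed

  define A where "A = K * (card B + 1) * (2 / t)"
  have A: "A > 0" using K(1) t(1) by (simp add: A_def)
  define \<kappa> where "\<kappa> = min (1 / 2) (2 * \<alpha> / A)"
  have \<kappa>: "0 < \<kappa>" "\<kappa> \<le> 1 / 2" "\<kappa> \<le> 2 * \<alpha> / A"
    using A assms(1) by (auto simp: \<kappa>_def)
  have "E w - E u \<le> (1 - \<kappa>) * (E v - E u)"
    if v: "E v \<le> M" and wv: "E w \<le> E v" and w: "\<forall>b\<in>B. \<forall>c. E w \<le> E (v + c *\<^sub>R b)" for v w
  proof -
    have excess0: "0 \<le> E v - E u"
      using order_trans[OF _ growth[of v], of 0] assms(1) by simp
    have "(E' v \<bullet> b)\<^sup>2 \<le> 2 / t * (E v - E w)" if "b \<in> B" for b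
      using gain[OF v that, of w] w that t(1) by (simp add: field_simps)
    then have "(\<Sum>b\<in>B. (E' v \<bullet> b)\<^sup>2) \<le> (\<Sum>b\<in>B. 2 / t * (E v - E w))"
      by (intro sum_mono) auto
    also have "\<dots> = card B * (2 / t * (E v - E w))" by simp
    also have "\<dots> \<le> (card B + 1) * (2 / t * (E v - E w))"
      using wv t(1) by (intro mult_right_mono) auto
    finally have "(\<Sum>b\<in>B. (E' v \<bullet> b)\<^sup>2) \<le> (card B + 1) * (2 / t * (E v - E w))" .
    from mult_left_mono[OF this less_imp_le[OF K(1)]]
    have "K * (\<Sum>b\<in>B. (E' v \<bullet> b)\<^sup>2) \<le> A * (E v - E w)"
      by (simp only: A_def mult.assoc)
    then have "(norm (E' v))\<^sup>2 \<le> A * (E v - E w)"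
      using K(2)[of "E' v"] by linarith
    then have "2 * \<alpha> * (E v - E u) \<le> A * (E v - E w)"
      using energy_excess_le_gradient_sq[OF assms(1) convex, of v u] by linarith
    then have "2 * \<alpha> / A * (E v - E u) \<le> E v - E w"
      using A by (simp add: field_simps)
    moreover have "\<kappa> * (E v - E u) \<le> 2 * \<alpha> / A * (E v - E u)"
      using \<kappa>(3) excess0 by (rule mult_right_mono)
    ultimately show ?thesis by (simp add: algebra_simps)
  qed
  then show ?thesis
    using \<kappa> by (intro exI[of _ "1 - \<kappa>"]) auto
qed

section \<open>The tensor product map\<close>

text \<open>
  Bilinearity holds for the point values; functions in \<open>V\<close> that agree on \<open>T \<times> X\<close> are equal, so it
  carries over to the elements of \<open>V\<close>.
\<close>

lemma tensor_product_bilinear: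
  assumes "function_space_on T evt" "function_space_on X evx" "function_space_on (T \<times> X) ev"
    and tens: "is_tensor_product T X evt evx ev tens"
  shows "bilinear tens"
proof -
  have evt: "linear (\<lambda>v. evt v t)" if "t \<in> T" for t
    using assms(1) that by (auto simp: function_space_on_def)
  have evx: "linear (\<lambda>v. evx v x)" if "x \<in> X" for x
    using assms(2) that by (auto simp: function_space_on_def)
  have ev: "linear (\<lambda>v. ev v (t, x))" if "t \<in> T" "x \<in> X" for t x
    using assms(3) that by (auto simp: function_space_on_def)
  have eqI: "v = w" if "\<And>t x. t \<in> T \<Longrightarrow> x \<in> X \<Longrightarrow> ev v (t, x) = ev w (t, x)" for v w
    using assms(3) that by (auto simp: function_space_on_def)
  have val: "ev (tens r s) (t, x) = evt r t * evx s x" if "t \<in> T" "x \<in> X" for r s t x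
    using tens that by (auto simp: is_tensor_product_def)
  note lin_simps = linear_add[OF evt] linear_add[OF evx] linear_add[OF ev]
    linear_scale[OF evt] linear_scale[OF evx] linear_scale[OF ev]
  show ?thesis
    unfolding bilinear_def
    by (intro conjI allI linearI; rule eqI) (simp_all add: val lin_simps algebra_simps)
qed

lemma bilinear_range_subset_span:
  assumes "bilinear f" and "span A = UNIV" and "span B = UNIV"
  shows "f x y \<in> span ((\<lambda>(a, b). f a b) ` (A \<times> B))"
proof -
  let ?P = "(\<lambda>(a, b). f a b) ` (A \<times> B)"
  have lin: "linear (f a)" "linear (\<lambda>a. f a b)" for a b
    using assms(1) by (auto simp: bilinear_def)
  have "f a b \<in> span ?P" if "a \<in> A" for a b
  proof -
    have "f a b \<in> span (f a ` B)"
      using linear_span_image[OF lin(1)[of a], of B] assms(3) by auto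
    also have "\<dots> \<subseteq> span ?P"
      using that by (intro span_mono) auto
    finally show ?thesis .
  qed
  then have "(\<lambda>a. f a y) ` A \<subseteq> span ?P" by auto
  then have "span ((\<lambda>a. f a y) ` A) \<subseteq> span ?P"
    by (simp add: span_minimal)
  then show ?thesis
    using linear_span_image[OF lin(2)[of y], of A] assms(2) by auto
qed

section \<open>Geometric convergence of the greedy algorithm\<close>

lemma greedy_iterate_Suc_le:
  assumes "greedy_choice E tens r s"
  shows "E (greedy_iterate tens r s (Suc n)) \<le> E (greedy_iterate tens r s n + tens a b)"
proof -
  have "is_arg_min (\<lambda>(a, b). E ((\<Sum>k=1..<Suc n. tens (r k) (s k)) + tens a b))
      (\<lambda>_. True) (r (Suc n), s (Suc n))"
    using assms by (simp add: greedy_choice_def del: sum.op_ivl_Suc)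
  then show ?thesis
    by (auto simp: is_arg_min_linorder greedy_iterate_def atLeastLessThanSuc_atLeastAtMost)
qed

theorem theorem4p1:
  fixes T :: "(real ^ 'p) set" and X :: "(real ^ 'd) set"
    and evt :: "'r::{real_inner, complete_space} \<Rightarrow> real ^ 'p \<Rightarrow> real"
    and evx :: "'s::{real_inner, complete_space} \<Rightarrow> real ^ 'd \<Rightarrow> real"
    and ev :: "'v::{real_inner, complete_space} \<Rightarrow> (real ^ 'p) \<times> (real ^ 'd) \<Rightarrow> real"
    and tens :: "'r \<Rightarrow> 's \<Rightarrow> 'v"
    and E :: "'v \<Rightarrow> real" and E' :: "'v \<Rightarrow> 'v"
    and \<alpha> :: real and u :: 'v
    and r :: "nat \<Rightarrow> 'r" and s :: "nat \<Rightarrow> 's"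
  assumes "open T" and "open X"
    and "function_space_on T evt" and "function_space_on X evx"
    and "function_space_on (T \<times> X) ev"
    and fin_t: "\<exists>B :: 'r set. finite B \<and> span B = UNIV"
    and fin_x: "\<exists>B :: 's set. finite B \<and> span B = UNIV"
    and tens: "is_tensor_product T X evt evx ev tens"
    and gradient: "\<And>v. GDERIV E v :> E' v"
    and A1: "closure (span (rank_one tens)) = UNIV"
    and A2: "weakly_seq_compact_on_bounded (rank_one tens)"
    and A3: "\<alpha> > 0"
      "\<And>v w. E v \<ge> E w + E' w \<bullet> (v - w) + \<alpha> / 2 * (norm (v - w))\<^sup>2"
    and A4: "\<And>K. bounded K \<Longrightarrow> \<exists>L. L-lipschitz_on K E'"
    and minimizer: "is_arg_min E (\<lambda>_. True) u"
    and greedy: "greedy_choice E tens r s"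
  shows "\<exists>\<tau> \<sigma> :: real. \<tau> > 0 \<and> 0 < \<sigma> \<and> \<sigma> < 1 \<and>
    (\<forall>n\<ge>1. 0 \<le> E (greedy_iterate tens r s n) - E u \<and>
       E (greedy_iterate tens r s n) - E u \<le> \<tau> * \<sigma> ^ n \<and>
       norm (u - greedy_iterate tens r s n) \<le> sqrt (2 * \<tau> / \<alpha>) * \<sigma> powr (real n / 2))"
proof -
  let ?u = "greedy_iterate tens r s"
  have bil: "bilinear tens"
    using tensor_product_bilinear assms(3-5) tens by blast
  have u_min: "E u \<le> E v" for v
    using minimizer by (auto simp: is_arg_min_linorder)
  have crit: "E' u = 0"
    using gradient_zero_at_minimizer[OF gradient u_min] .
  obtain Bt :: "'r set" and Bx :: "'s set"
    where Bt: "finite Bt" "span Bt = UNIV" and Bx: "finite Bx" "span Bx = UNIV"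
    using fin_t fin_x by blast
  define B where "B = (\<lambda>(a, b). tens a b) ` (Bt \<times> Bx)"
  have "rank_one tens \<subseteq> span B"
    using bilinear_range_subset_span[OF bil Bt(2) Bx(2)] by (auto simp: rank_one_def B_def)
  then have "closure (span (rank_one tens)) \<subseteq> closure (span B)"
    by (intro closure_mono) (simp add: span_minimal)
  then have dense: "closure (span B) = UNIV" using A1 by (simp add: top.extremum_unique)
  have finB: "finite B" using Bt Bx by (simp add: B_def)
  obtain \<sigma> where \<sigma>: "0 < \<sigma>" "\<sigma> < 1" and contraction:
      "\<And>v w. \<lbrakk>E v \<le> E 0; E w \<le> E v; \<forall>b\<in>B. \<forall>c. E w \<le> E (v + c *\<^sub>R b)\<rbrakk>
        \<Longrightarrow> E w - E u \<le> \<sigma> * (E v - E u)"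
    using line_search_contraction[OF A3 A4 crit finB dense, of "E 0"] by metis

  \<comment> \<open>The zero tensor and the multiples of the elements of \<open>B\<close> are candidates in the greedy choice.\<close>
  have decreasing: "E (?u (Suc n)) \<le> E (?u n)" for n
    using greedy_iterate_Suc_le[OF greedy, of n 0 0] bilinear_lzero[OF bil] by simp
  have below_start: "E (?u n) \<le> E 0" for n
  proof (induction n)
    case 0
    then show ?case by (simp add: greedy_iterate_def)
  qed (use decreasing order_trans in blast)
  have step: "E (?u (Suc n)) - E u \<le> \<sigma> * (E (?u n) - E u)" for n
  proof (rule contraction[OF below_start decreasing], intro ballI allI)
    fix z c assume "z \<in> B"
    then obtain a b where "z = tens a b" by (auto simp: B_def)
    then have "c *\<^sub>R z = tens (c *\<^sub>R a) b" by (simp add: bilinear_lmul[OF bil])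
    then show "E (?u (Suc n)) \<le> E (?u n + c *\<^sub>R z)"
      using greedy_iterate_Suc_le[OF greedy] by simp
  qed

  \<comment> \<open>The summand \<open>1\<close> keeps \<open>\<tau>\<close> positive when \<open>0\<close> is already the minimizer.\<close>
  define \<tau> where "\<tau> = E 0 - E u + 1"
  have \<tau>: "\<tau> > 0" using u_min[of 0] by (simp add: \<tau>_def)
  have decay: "E (?u n) - E u \<le> \<tau> * \<sigma> ^ n" for n
  proof (induction n)
    case 0
    then show ?case by (simp add: greedy_iterate_def \<tau>_def)
  next
    case (Suc n)
    then show ?case
      using step[of n] mult_left_mono[OF Suc, of \<sigma>] \<sigma> by (simp add: algebra_simps)
  qed
  have "norm (u - ?u n) \<le> sqrt (2 * \<tau> / \<alpha>) * \<sigma> powr (real n / 2)" for n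
  proof -
    have "\<alpha> / 2 * (norm (?u n - u))\<^sup>2 \<le> \<tau> * \<sigma> ^ n"
      using A3(2)[of u "?u n"] crit decay[of n] by simp
    then have "(norm (u - ?u n))\<^sup>2 \<le> 2 * \<tau> / \<alpha> * \<sigma> ^ n"
      using A3(1) by (simp add: field_simps norm_minus_commute)
    then have "norm (u - ?u n) \<le> sqrt (2 * \<tau> / \<alpha> * \<sigma> ^ n)"
      by (rule real_le_rsqrt)
    also have "\<dots> = sqrt (2 * \<tau> / \<alpha>) * sqrt (\<sigma> ^ n)"
      by (rule real_sqrt_mult)
    also have "sqrt (\<sigma> ^ n) = (\<sigma> powr real n) powr (1 / 2)"
      using \<sigma>(1) by (simp add: powr_half_sqrt powr_realpow)
    also have "\<dots> = \<sigma> powr (real n / 2)"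
      by (simp add: powr_powr)
    finally show ?thesis .
  qed
  then show ?thesis
    using \<tau> \<sigma> decay u_min by (intro exI[of _ \<tau>] exI[of _ \<sigma>]) auto
qed

end
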